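(* Let $X$ be non-empty and let $(X,\mathcal{T}_1,\mathcal{T}_2,E)$ be a bi-soft topological space over $X$. Suppose that for all $x,y\in X$ with $x\neq y$ there exist a $\mathcal{T}_1$-soft open set $(F,E)$ such that $x\in(F,E)$, $y\in(F,E)^c$ and a $\mathcal{T}_2$-soft open set $(G,E)$ such that $y\in(G,E)$, $x\in(G,E)^c$. Then $(X,\mathcal{T}_1,\mathcal{T}_2,E)$ is a pair-wise soft $T_1$-space over $X$, and $(X,\mathcal{T}_{1e},\mathcal{T}_{2e})$ is a pair-wise $T_1$-space for each $e\in E$.
   Context: $X$ is the initial universe and $E$ is a non-empty set of parameters. A soft set $(F,E)$ over $X$ is a map $F:E\to\mathcal{P}(X)$, where $\mathcal{P}(X)$ is the power set of $X$. Unions, intersections and complements of soft sets are taken parameterwise; in particular $(F,E)^c$ has value $X-F(e)$ at each $e\in E$. $\Phi$ denotes the soft set with value $\emptyset$ at every $e\in E$ and $\widetilde{X}$ the soft set with value $X$ at every $e\in E$. For $x\in X$, $x\in(F,E)$ means $x\in F(e)$ for all $e\in E$ (so $x\notin(F,E)$ means $x\notin F(e)$ for some $e\in E$). A soft topology on $X$ is a collection $\mathcal{T}$ of soft sets over $X$ (with parameter set $E$) containing $\Phi$ and $\widetilde{X}$ and closed under arbitrary unions and under intersections of two members; its members are called soft open. A bi-soft topological space $(X,\mathcal{T}_1,\mathcal{T}_2,E)$ consists of two soft topologies $\mathcal{T}_1,\mathcal{T}_2$ on $X$ with the same parameter set $E$. For $e\in E$ and $i=1,2$, $\mathcal{T}_{ie}=\{F(e)\mid(F,E)\in\mathcal{T}_i\}$,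 which is a topology on $X$. A bitopological space is a non-empty set with two topologies. $(X,\mathcal{T}_1,\mathcal{T}_2,E)$ is a pair-wise soft $T_1$-space if for all $x,y\in X$ with $x\neq y$ there are $(F,E)\in\mathcal{T}_1$ with $x\in(F,E)$, $y\notin(F,E)$ and $(G,E)\in\mathcal{T}_2$ with $x\notin(G,E)$, $y\in(G,E)$. A bitopological space $(X,\mathcal{P},\mathcal{Q})$ is pair-wise $T_1$ if for all $x,y\in X$ with $x\ne y$ there exist $U\in\mathcal{P}$, $V\in\mathcal{Q}$ such that $x\in U$, $y\notin U$ and $x\notin V$, $y\in V$. *)

theory Defs
  imports "HOL-Analysis.Abstract_Topology" "HOL-Library.FuncSet"
begin

text \<open>A soft set over \<open>X\<close> is a map from \<open>E\<close> to the power set of \<open>X\<close>. Such maps are taken to be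
  extensional (\<open>undefined\<close> outside \<open>E\<close>), so that equality of HOL functions is equality of soft sets.\<close>

definition soft_sets :: "'a set \<Rightarrow> 'e set \<Rightarrow> ('e \<Rightarrow> 'a set) set" where
  "soft_sets X E = E \<rightarrow>\<^sub>E Pow X"

definition soft_empty :: "'e set \<Rightarrow> 'e \<Rightarrow> 'a set" where
  "soft_empty E = (\<lambda>e\<in>E. {})"

definition soft_univ :: "'a set \<Rightarrow> 'e set \<Rightarrow> 'e \<Rightarrow> 'a set" where
  "soft_univ X E = (\<lambda>e\<in>E. X)"

definition soft_Union :: "'e set \<Rightarrow> ('e \<Rightarrow> 'a set) set \<Rightarrow> 'e \<Rightarrow> 'a set" where
  "soft_Union E \<F> = (\<lambda>e\<in>E. \<Union>F\<in>\<F>. F e)"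

definition soft_Int :: "'e set \<Rightarrow> ('e \<Rightarrow> 'a set) \<Rightarrow> ('e \<Rightarrow> 'a set) \<Rightarrow> 'e \<Rightarrow> 'a set" where
  "soft_Int E F G = (\<lambda>e\<in>E. F e \<inter> G e)"

definition soft_compl :: "'a set \<Rightarrow> 'e set \<Rightarrow> ('e \<Rightarrow> 'a set) \<Rightarrow> 'e \<Rightarrow> 'a set" where
  "soft_compl X E F = (\<lambda>e\<in>E. X - F e)"

text \<open>Non-membership is the plain negation: \<open>x\<close> lies outside \<open>F e\<close> for some \<open>e\<close>. It is weaker
  than membership in the soft complement.\<close>

definition soft_mem :: "'e set \<Rightarrow> 'a \<Rightarrow> ('e \<Rightarrow> 'a set) \<Rightarrow> bool" where
  "soft_mem E x F \<longleftrightarrow> (\<forall>e\<in>E. x \<in> F e)"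

definition soft_topology :: "'a set \<Rightarrow> 'e set \<Rightarrow> ('e \<Rightarrow> 'a set) set \<Rightarrow> bool" where
  "soft_topology X E \<T> \<longleftrightarrow>
     \<T> \<subseteq> soft_sets X E \<and>
     soft_empty E \<in> \<T> \<and> soft_univ X E \<in> \<T> \<and>
     (\<forall>\<F>. \<F> \<subseteq> \<T> \<longrightarrow> soft_Union E \<F> \<in> \<T>) \<and>
     (\<forall>F\<in>\<T>. \<forall>G\<in>\<T>. soft_Int E F G \<in> \<T>)"

definition bisoft_topological_space ::
    "'a set \<Rightarrow> ('e \<Rightarrow> 'a set) set \<Rightarrow> ('e \<Rightarrow> 'a set) set \<Rightarrow> 'e set \<Rightarrow> bool" where
  "bisoft_topological_space X \<T>1 \<T>2 E \<longleftrightarrow> soft_topology X E \<T>1 \<and> soft_topology X E \<T>2"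

definition pairwise_soft_T1_space ::
    "'a set \<Rightarrow> ('e \<Rightarrow> 'a set) set \<Rightarrow> ('e \<Rightarrow> 'a set) set \<Rightarrow> 'e set \<Rightarrow> bool" where
  "pairwise_soft_T1_space X \<T>1 \<T>2 E \<longleftrightarrow>
     bisoft_topological_space X \<T>1 \<T>2 E \<and>
     (\<forall>x\<in>X. \<forall>y\<in>X. x \<noteq> y \<longrightarrow>
        (\<exists>F\<in>\<T>1. soft_mem E x F \<and> \<not> soft_mem E y F) \<and>
        (\<exists>G\<in>\<T>2. \<not> soft_mem E x G \<and> soft_mem E y G))"

definition parameter_topology :: "('e \<Rightarrow> 'a set) set \<Rightarrow> 'e \<Rightarrow> 'a set set" where
  "parameter_topology \<T> e = (\<lambda>F. F e) ` \<T>"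

text \<open>Topologies are kept as families of sets, so that being a topology on \<open>X\<close> is part of the
  claim. Closure under unions in \<^const>\<open>istopology\<close> yields the empty set and, with
  \<open>\<Union>\<P> = X\<close>, also \<open>X \<in> \<P>\<close>.\<close>

definition bitopological_space :: "'a set \<Rightarrow> 'a set set \<Rightarrow> 'a set set \<Rightarrow> bool" where
  "bitopological_space X \<P> \<Q> \<longleftrightarrow>
     X \<noteq> {} \<and>
     istopology (\<lambda>U. U \<in> \<P>) \<and> \<Union>\<P> = X \<and>
     istopology (\<lambda>U. U \<in> \<Q>) \<and> \<Union>\<Q> = X"

definition pairwise_T1_space :: "'a set \<Rightarrow> 'a set set \<Rightarrow> 'a set set \<Rightarrow> bool" where
  "pairwise_T1_space X \<P> \<Q> \<longleftrightarrow>
     bitopological_space X \<P> \<Q> \<and>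
     (\<forall>x\<in>X. \<forall>y\<in>X. x \<noteq> y \<longrightarrow>
        (\<exists>U\<in>\<P>. \<exists>V\<in>\<Q>. x \<in> U \<and> y \<notin> U \<and> x \<notin> V \<and> y \<in> V))"

end

theory Submission
  imports Defs
begin

text \<open>Membership of a point in a soft complement says that the point is missing at every
  parameter, while soft non-membership only asks that it be missing at some parameter. Since there
  is at least one parameter, the former implies the latter, and the separating soft sets of the
  hypothesis already witness the soft \<open>T\<^sub>1\<close> property.

  Because the hypothesis controls every parameter at once, evaluating the same soft sets at a fixed
  \<open>e\<close> gives open sets that separate the two points in the slice at \<open>e\<close>. What is
  left is that a slice is a topology: evaluation at \<open>e\<close> commutes with the parameterwise
  unions and intersections (lemmas \<open>istopology_parameter_topology\<close> and
  \<open>Union_parameter_topology\<close>).\<close>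

lemma soft_mem_complD:
  assumes "soft_mem E y (soft_compl X E F)" and "e \<in> E"
  shows "y \<notin> F e"
  using assms by (auto simp: soft_mem_def soft_compl_def)

text \<open>This is the step that fails for an empty parameter set: every point would then
  belong both to a soft set and to its complement.\<close>

lemma soft_mem_compl_imp_not_soft_mem:
  assumes "soft_mem E y (soft_compl X E F)" and "E \<noteq> {}"
  shows "\<not> soft_mem E y F"
  using assms by (auto simp: soft_mem_def soft_compl_def)

lemma istopology_parameter_topology:
  assumes T: "soft_topology X E \<T>" and e: "e \<in> E"
  shows "istopology (\<lambda>U. U \<in> parameter_topology \<T> e)"
  unfolding istopology_def
proof (intro conjI allI impI)
  fix U V
  assume "U \<in> parameter_topology \<T> e" "V \<in> parameter_topology \<T> e"
  then obtain F G where FG: "F \<in> \<T>" "G \<in> \<T>" "U = F e" "V = G e"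
    by (auto simp: parameter_topology_def)
  then have "soft_Int E F G \<in> \<T>"
    using T by (auto simp: soft_topology_def)
  moreover have "U \<inter> V = soft_Int E F G e"
    using FG e by (simp add: soft_Int_def)
  ultimately show "U \<inter> V \<in> parameter_topology \<T> e"
    by (auto simp: parameter_topology_def)
next
  fix \<K>
  assume \<K>: "\<forall>U\<in>\<K>. U \<in> parameter_topology \<T> e"
  \<comment> \<open>Taking all soft open sets that evaluate into the family avoids choosing a representative
    for each of its members.\<close>
  define \<F> where "\<F> = {F \<in> \<T>. F e \<in> \<K>}"
  have "soft_Union E \<F> \<in> \<T>"
    using T by (auto simp: soft_topology_def \<F>_def)
  moreover have "\<Union>\<K> = soft_Union E \<F> e"
  proof -
    have "\<K> = (\<lambda>F. F e) ` \<F>"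
      using \<K> by (auto simp: \<F>_def parameter_topology_def)
    then show ?thesis
      using e by (simp add: soft_Union_def)
  qed
  ultimately show "\<Union>\<K> \<in> parameter_topology \<T> e"
    by (auto simp: parameter_topology_def)
qed

lemma Union_parameter_topology:
  assumes T: "soft_topology X E \<T>" and e: "e \<in> E"
  shows "\<Union>(parameter_topology \<T> e) = X"
proof
  show "\<Union>(parameter_topology \<T> e) \<subseteq> X"
  proof
    fix x assume "x \<in> \<Union>(parameter_topology \<T> e)"
    then obtain F where F: "F \<in> \<T>" "x \<in> F e"
      by (auto simp: parameter_topology_def)
    have "F \<in> E \<rightarrow>\<^sub>E Pow X"
      using T F(1) by (auto simp: soft_topology_def soft_sets_def)
    from PiE_mem[OF this e] show "x \<in> X"
      using F(2) by auto
  qed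
  have "soft_univ X E \<in> \<T>"
    using T by (simp add: soft_topology_def)
  moreover have "soft_univ X E e = X"
    using e by (simp add: soft_univ_def)
  ultimately show "X \<subseteq> \<Union>(parameter_topology \<T> e)"
    by (auto simp: parameter_topology_def)
qed

lemma bitopological_space_parameter_topology:
  assumes "X \<noteq> {}" and "bisoft_topological_space X \<T>1 \<T>2 E" and "e \<in> E"
  shows "bitopological_space X (parameter_topology \<T>1 e) (parameter_topology \<T>2 e)"
proof -
  have "soft_topology X E \<T>1" "soft_topology X E \<T>2"
    using assms(2) by (auto simp: bisoft_topological_space_def)
  then show ?thesis
    unfolding bitopological_space_def
    by (intro conjI assms(1) istopology_parameter_topology[OF _ assms(3)]
        Union_parameter_topology[OF _ assms(3)])
qed

theorem proposition9:
  fixes X :: "'a set" and E :: "'e set" and \<T>1 \<T>2 :: "('e \<Rightarrow> 'a set) set"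
  assumes "X \<noteq> {}" and "E \<noteq> {}"
    and "bisoft_topological_space X \<T>1 \<T>2 E"
    and "\<And>x y. x \<in> X \<Longrightarrow> y \<in> X \<Longrightarrow> x \<noteq> y \<Longrightarrow>
           (\<exists>F\<in>\<T>1. soft_mem E x F \<and> soft_mem E y (soft_compl X E F)) \<and>
           (\<exists>G\<in>\<T>2. soft_mem E y G \<and> soft_mem E x (soft_compl X E G))"
  shows "pairwise_soft_T1_space X \<T>1 \<T>2 E \<and>
         (\<forall>e\<in>E. pairwise_T1_space X (parameter_topology \<T>1 e) (parameter_topology \<T>2 e))"
proof (intro conjI ballI)
  show "pairwise_soft_T1_space X \<T>1 \<T>2 E"
    unfolding pairwise_soft_T1_space_def
  proof (intro conjI ballI impI)
    show "bisoft_topological_space X \<T>1 \<T>2 E"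
      by (fact assms(3))
  next
    fix x y assume xy: "x \<in> X" "y \<in> X" "x \<noteq> y"
    from assms(4)[OF xy] obtain F G
      where F: "F \<in> \<T>1" "soft_mem E x F" "soft_mem E y (soft_compl X E F)"
        and G: "G \<in> \<T>2" "soft_mem E y G" "soft_mem E x (soft_compl X E G)"
      by (elim conjE bexE)
    show "\<exists>F\<in>\<T>1. soft_mem E x F \<and> \<not> soft_mem E y F"
      using F(1,2) soft_mem_compl_imp_not_soft_mem[OF F(3) assms(2)] by (intro bexI conjI)
    show "\<exists>G\<in>\<T>2. \<not> soft_mem E x G \<and> soft_mem E y G"
      using G(1,2) soft_mem_compl_imp_not_soft_mem[OF G(3) assms(2)] by (intro bexI conjI)
  qed
next
  fix e assume e: "e \<in> E"
  have "\<exists>U\<in>parameter_topology \<T>1 e. \<exists>V\<in>parameter_topology \<T>2 e.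
          x \<in> U \<and> y \<notin> U \<and> x \<notin> V \<and> y \<in> V"
    if xy: "x \<in> X" "y \<in> X" "x \<noteq> y" for x y
  proof -
    from assms(4)[OF xy] obtain F G
      where F: "F \<in> \<T>1" "soft_mem E x F" "soft_mem E y (soft_compl X E F)"
        and G: "G \<in> \<T>2" "soft_mem E y G" "soft_mem E x (soft_compl X E G)"
      by (elim conjE bexE)
    have "x \<in> F e" "y \<in> G e"
      using F(2) G(2) e by (auto simp: soft_mem_def)
    moreover have "y \<notin> F e" "x \<notin> G e"
      using soft_mem_complD[OF F(3) e] soft_mem_complD[OF G(3) e] by auto
    ultimately show ?thesis
      using F(1) G(1) by (auto simp: parameter_topology_def)
  qed
  then show "pairwise_T1_space X (parameter_topology \<T>1 e) (parameter_topology \<T>2 e)"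
    using bitopological_space_parameter_topology[OF assms(1,3) e]
    by (simp add: pairwise_T1_space_def)
qed

end
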